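(* Let $S_1:\mathbb{R}^n\rightrightarrows\mathbb{R}^m$ and $S_2:\mathbb{R}^m\rightrightarrows\mathbb{R}^s$ be set-valued maps with closed graphs, let $S=S_2\circ S_1$ and $(\bar x,\bar z)\in\mathrm{gph}\,S$. Define $\Xi:\mathbb{R}^n\times\mathbb{R}^s\rightrightarrows\mathbb{R}^m$ by \[\Xi(x,z):=S_1(x)\cap S_2^{-1}(z)=\{y\in S_1(x): z\in S_2(y)\},\] and suppose that $\Xi$ is inner semicompact at $(\bar x,\bar z)$ with respect to $\mathrm{dom}\,\Xi$. Define also the set-valued mapping \[F(x,z,y):=\big(\mathrm{gph}\,S_1-(x,y)\big)\times\big(\mathrm{gph}\,S_2-(y,z)\big).\] If $\Xi$ is inner calm* at $(\bar x,\bar z)$ with respect to $\mathrm{dom}\,\Xi$ in the fuzzy sense, then \[DS(\bar x,\bar z)\subset\bigcup_{\bar y\in\Xi(\bar x,\bar z)}DS_2(\bar y,\bar z)\circ DS_1(\bar x,\bar y).\] On the other hand, for any $\bar y\in\Xi(\bar x,\bar z)$, the inclusion \[DS_2(\bar y,\bar z)\circ DS_1(\bar x,\bar y)\subset DS(\bar x,\bar z)\] holds provided $F$ is metrically subregular at $((\bar x,\bar z,\bar y),(0,0))$ and, for all $u\in\mathbb{R}^n$, $v\in\mathbb{R}^m$, $w\in\mathbb{R}^s$, \[(u,v,v,w)\in T_{\mathrm{gph}\,S_1\times\mathrm{gph}\,S_2}(\bar x,\bar y,\bar y,\bar z)\iff (u,v)\in T_{\mathrm{gph}\,S_1}(\bar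 x,\bar y),\ (v,w)\in T_{\mathrm{gph}\,S_2}(\bar y,\bar z).\]
   Context: $T_\Omega(\bar z)=\{w:\exists t_k\downarrow0,\,w_k\to w,\ \bar z+t_kw_k\in\Omega\ \forall k\}$ is the tangent (Bouligand) cone. $DS(\bar x,\bar z)(u):=\{w:(u,w)\in T_{\mathrm{gph}\,S}(\bar x,\bar z)\}$ is the graphical derivative. Composition of set-valued maps: $(S_2\circ S_1)(x)=\bigcup_{y\in S_1(x)}S_2(y)$. Inclusions and unions of set-valued maps are understood pointwise (for every argument $u$). Metric subregularity of $M$ at $(\bar x,\bar y)\in\mathrm{gph}\,M$: there are $\kappa>0$ and a neighbourhood $U$ of $\bar x$ with $\mathrm{dist}(x,M^{-1}(\bar y))\le\kappa\,\mathrm{dist}(\bar y,M(x))$ for all $x\in U$. For a set-valued map $S:\mathbb{R}^p\rightrightarrows\mathbb{R}^q$, $\mathrm{dom}\,S=\{y:S(y)\ne\emptyset\}$ and $\Omega\subset\mathbb{R}^p$: - $S$ is inner semicompact at $\bar y$ with respect to $\Omega$ if for every sequence $y_k\to\bar y$ with $y_k\in\Omega$ there exist an infinite $K\subset\mathbb{N}$ and $x_k\in S(y_k)$ ($k\in K$) converging to some $\bar x$; - $S$ is inner calm* at $\bar y$ with respect to $\Omega$ in the fuzzy sense if for every unit direction $v$, either $v\notin T_\Omega(\bar y)$, or there exist $\kappa_v>0$, a sequence $y_k\in\Omega$ converging to $\bar y$ from $v$ (i.e. $y_k=\bar y+t_kv_k$ with $t_k\downarrow0$, $v_k\to v$), $x_k\in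 S(y_k)$ and a point $\bar x\in\mathbb{R}^q$ with $\|x_k-\bar x\|\le\kappa_v\|y_k-\bar y\|$ for all $k$. *)

theory Defs
  imports "HOL-Analysis.Analysis"
begin

text \<open>A set-valued map from \<open>'a\<close> to \<open>'b\<close> is a function \<open>'a \<Rightarrow> 'b set\<close>.\<close>

definition gph :: "('a \<Rightarrow> 'b set) \<Rightarrow> ('a \<times> 'b) set" where
  "gph S = {(x, y). y \<in> S x}"

definition svm_dom :: "('a \<Rightarrow> 'b set) \<Rightarrow> 'a set" where
  "svm_dom S = {x. S x \<noteq> {}}"

definition svm_inv :: "('a \<Rightarrow> 'b set) \<Rightarrow> 'b \<Rightarrow> 'a set" where
  "svm_inv S y = {x. y \<in> S x}"

definition svm_comp :: "('b \<Rightarrow> 'c set) \<Rightarrow> ('a \<Rightarrow> 'b set) \<Rightarrow> 'a \<Rightarrow> 'c set" where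
  "svm_comp S2 S1 x = (\<Union>y\<in>S1 x. S2 y)"

text \<open>Throughout, \<open>t\<^sub>k \<down> 0\<close> is read as \<open>t\<^sub>k > 0\<close> for all \<open>k\<close> and \<open>t\<^sub>k \<rightarrow> 0\<close>. Monotonicity
  is not required; it could always be arranged by passing to a subsequence.\<close>

definition tangent_cone :: "'a::real_normed_vector set \<Rightarrow> 'a \<Rightarrow> 'a set" where
  "tangent_cone \<Omega> z =
    {w. \<exists>(t::nat \<Rightarrow> real) wk.
          (\<forall>k. t k > 0) \<and> t \<longlonglongrightarrow> 0 \<and> wk \<longlonglongrightarrow> w \<and> (\<forall>k. z + t k *\<^sub>R wk k \<in> \<Omega>)}"

definition graph_deriv ::
    "('a::real_normed_vector \<Rightarrow> 'b::real_normed_vector set) \<Rightarrow> 'a \<Rightarrow> 'b \<Rightarrow> 'a \<Rightarrow> 'b set" where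
  "graph_deriv S x z u = {w. (u, w) \<in> tangent_cone (gph S) (x, z)}"

text \<open>The distance to the empty set is \<open>\<infinity>\<close> in variational analysis, whereas \<open>infdist x {} = 0\<close>.
  The guard \<open>M x \<noteq> {}\<close> restores the intended meaning on the right of the estimate;
  on the left, \<open>svm_inv M y0\<close> contains \<open>x0\<close>.\<close>

definition metrically_subregular ::
    "('a::metric_space \<Rightarrow> 'b::metric_space set) \<Rightarrow> 'a \<Rightarrow> 'b \<Rightarrow> bool" where
  "metrically_subregular M x0 y0 \<longleftrightarrow>
    (x0, y0) \<in> gph M \<and>
    (\<exists>\<kappa>>0. \<exists>U. open U \<and> x0 \<in> U \<and>
      (\<forall>x\<in>U. M x \<noteq> {} \<longrightarrow> infdist x (svm_inv M y0) \<le> \<kappa> * infdist y0 (M x)))"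

text \<open>The infinite index set \<open>K\<close> is given by its increasing enumeration \<open>r\<close>;
  \<open>x k\<close> is the point chosen in \<open>S (y (r k))\<close>.\<close>

definition inner_semicompact ::
    "('a::topological_space \<Rightarrow> 'b::topological_space set) \<Rightarrow> 'a \<Rightarrow> 'a set \<Rightarrow> bool" where
  "inner_semicompact S y0 \<Omega> \<longleftrightarrow>
    (\<forall>y::nat \<Rightarrow> 'a. (\<forall>k. y k \<in> \<Omega>) \<and> y \<longlonglongrightarrow> y0 \<longrightarrow>
      (\<exists>(r::nat \<Rightarrow> nat) x x0. strict_mono r \<and> (\<forall>k. x k \<in> S (y (r k))) \<and> x \<longlonglongrightarrow> x0))"

definition inner_calm_star_fuzzy ::
    "('a::real_normed_vector \<Rightarrow> 'b::real_normed_vector set) \<Rightarrow> 'a \<Rightarrow> 'a set \<Rightarrow> bool" where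
  "inner_calm_star_fuzzy S y0 \<Omega> \<longleftrightarrow>
    (\<forall>v. norm v = 1 \<longrightarrow>
      v \<notin> tangent_cone \<Omega> y0 \<or>
      (\<exists>\<kappa>>0. \<exists>(y::nat \<Rightarrow> 'a) (t::nat \<Rightarrow> real) vk x x0.
        (\<forall>k. y k \<in> \<Omega>) \<and>
        (\<forall>k. t k > 0) \<and> t \<longlonglongrightarrow> 0 \<and> vk \<longlonglongrightarrow> v \<and> (\<forall>k. y k = y0 + t k *\<^sub>R vk k) \<and>
        (\<forall>k. x k \<in> S (y k)) \<and>
        (\<forall>k. norm (x k - x0) \<le> \<kappa> * norm (y k - y0))))"

definition Xi :: "('a \<Rightarrow> 'b set) \<Rightarrow> ('b \<Rightarrow> 'c set) \<Rightarrow> 'a \<times> 'c \<Rightarrow> 'b set" where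
  "Xi S1 S2 = (\<lambda>(x, z). S1 x \<inter> svm_inv S2 z)"

definition F_map ::
    "('a::real_normed_vector \<Rightarrow> 'b::real_normed_vector set) \<Rightarrow>
     ('b \<Rightarrow> 'c::real_normed_vector set) \<Rightarrow> 'a \<times> 'c \<times> 'b \<Rightarrow> (('a \<times> 'b) \<times> ('b \<times> 'c)) set" where
  "F_map S1 S2 =
    (\<lambda>(x, z, y). ((\<lambda>p. p - (x, y)) ` gph S1) \<times> ((\<lambda>p. p - (y, z)) ` gph S2))"

end

theory Submission
  imports Defs
begin

text \<open>
  A pair \<open>(x, z)\<close> lies in the graph of \<open>S\<^sub>2 \<circ> S\<^sub>1\<close> exactly when some intermediate point \<open>y\<close> has
  \<open>(x, y) \<in> gph S\<^sub>1\<close> and \<open>(y, z) \<in> gph S\<^sub>2\<close>. Both inclusions of the chain rule compare difference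
  quotients of pairs \<open>(x\<^sub>k, z\<^sub>k)\<close> with difference quotients of such intermediate points.

  For the upper estimate, a tangent direction \<open>(u, w)\<close> of \<open>gph S\<close> says nothing by itself about
  how the intermediate points move. Inner calmness* in the fuzzy sense supplies, in the direction
  \<open>(u, w)\<close>, a sequence of intermediate points whose distance to some \<open>\<bar>y\<close> is of the order of the
  step length. Their difference quotients are then bounded, and a limit of a
  subsequence is the vector \<open>v\<close> with \<open>v \<in> DS\<^sub>1(u)\<close> and \<open>w \<in> DS\<^sub>2(v)\<close>; closedness of the graphs puts
  \<open>\<bar>y\<close> into \<open>\<Xi>(\<bar>x, \<bar>z)\<close>. Calmness only speaks about unit directions, which suffices for all nonzero
  ones because tangent cones are invariant under scaling; the zero direction is trivial
  (\<open>graph_deriv_comp_subset\<close>).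

  For the lower estimate, the assumption on the tangent cone of the product says that
  tangent directions \<open>(u, v)\<close> and \<open>(v, w)\<close> can be realised with the same step lengths \<open>t\<^sub>k\<close>. The two
  resulting middle points \<open>\<bar>y + t\<^sub>k v\<^sub>k\<close> and \<open>\<bar>y + t\<^sub>k v'\<^sub>k\<close> differ only by \<open>o(t\<^sub>k)\<close>. This difference is
  the residual of \<open>F\<close>, and the zeros of \<open>F\<close> are the matching triples; so metric subregularity
  corrects the sequence to a matching one at a cost of \<open>o(t\<^sub>k)\<close>, which does not change the
  limiting direction (\<open>comp_subset_graph_deriv\<close>).
\<close>

section \<open>Tangent cones\<close>

lemma tangent_coneI:
  assumes "\<And>k. t k > 0" "t \<longlonglongrightarrow> 0" "\<forall>\<^sub>F k in sequentially. p k \<in> \<Omega>"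
    and "(\<lambda>k. (p k - z) /\<^sub>R t k) \<longlonglongrightarrow> w"
  shows "w \<in> tangent_cone \<Omega> z"
proof -
  obtain N where N: "\<And>k. k \<ge> N \<Longrightarrow> p k \<in> \<Omega>"
    using assms(3) by (auto simp: eventually_sequentially)
  have "z + t (k + N) *\<^sub>R ((p (k + N) - z) /\<^sub>R t (k + N)) \<in> \<Omega>" for k
    using N[of "k + N"] assms(1)[of "k + N"] by simp
  then show ?thesis
    unfolding tangent_cone_def
    using assms(1) LIMSEQ_ignore_initial_segment[OF assms(2), of N]
      LIMSEQ_ignore_initial_segment[OF assms(4), of N]
    by (auto intro!: exI[of _ "\<lambda>k. t (k + N)"] exI[of _ "\<lambda>k. (p (k + N) - z) /\<^sub>R t (k + N)"])
qed

lemma zero_in_tangent_cone: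
  assumes "z \<in> \<Omega>"
  shows "0 \<in> tangent_cone \<Omega> z"
proof (rule tangent_coneI[of "\<lambda>k. 1 / real (Suc k)" "\<lambda>_. z"])
  show "(\<lambda>k. 1 / real (Suc k)) \<longlonglongrightarrow> 0" by (rule LIMSEQ_Suc[OF lim_1_over_n])
qed (use assms in auto)

lemma tangent_cone_scaleR:
  assumes "w \<in> tangent_cone \<Omega> z" "c > 0"
  shows "c *\<^sub>R w \<in> tangent_cone \<Omega> z"
proof -
  obtain t wk where t: "\<And>k. t k > 0" "t \<longlonglongrightarrow> 0"
    and w: "wk \<longlonglongrightarrow> w" "\<And>k. z + t k *\<^sub>R wk k \<in> \<Omega>"
    using assms(1) unfolding tangent_cone_def by blast
  show ?thesis
  proof (rule tangent_coneI[of "\<lambda>k. t k / c" "\<lambda>k. z + t k *\<^sub>R wk k"])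
    show "(\<lambda>k. t k / c) \<longlonglongrightarrow> 0"
      using tendsto_divide[OF t(2) tendsto_const[of c]] assms(2) by simp
    have "(z + t k *\<^sub>R wk k - z) /\<^sub>R (t k / c) = c *\<^sub>R wk k" for k
      using t(1)[of k] by simp
    then show "(\<lambda>k. (z + t k *\<^sub>R wk k - z) /\<^sub>R (t k / c)) \<longlonglongrightarrow> c *\<^sub>R w"
      using tendsto_scaleR[OF tendsto_const[of c] w(1)] by (simp only:)
  qed (use t assms w in auto)
qed

lemma graph_deriv_scaleR:
  assumes "w \<in> graph_deriv S x z u" "c > 0"
  shows "c *\<^sub>R w \<in> graph_deriv S x z (c *\<^sub>R u)"
  using tangent_cone_scaleR[of "(u, w)"] assms by (simp add: graph_deriv_def)

lemma svm_comp_graph_deriv_scaleR: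
  assumes "w \<in> svm_comp (graph_deriv S2 y z) (graph_deriv S1 x y) u" "c > 0"
  shows "c *\<^sub>R w \<in> svm_comp (graph_deriv S2 y z) (graph_deriv S1 x y) (c *\<^sub>R u)"
  using assms unfolding svm_comp_def by (auto intro: graph_deriv_scaleR)

section \<open>The intermediate map\<close>

lemma mem_Xi_iff: "y \<in> Xi S1 S2 (x, z) \<longleftrightarrow> (x, y) \<in> gph S1 \<and> (y, z) \<in> gph S2"
  by (auto simp: Xi_def svm_inv_def gph_def)

lemma svm_dom_Xi: "svm_dom (Xi S1 S2) = gph (svm_comp S2 S1)"
  by (auto simp: svm_dom_def gph_def svm_comp_def Xi_def svm_inv_def)

section \<open>The upper estimate\<close>

text \<open>Linear speed of the intermediate points is all that is needed to split a direction of the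
  composition: their difference quotients stay bounded, so by compactness of balls they have a
  limit along a subsequence, and this limit is the intermediate direction.\<close>

lemma intermediate_direction:
  fixes S1 :: "'a::real_normed_vector \<Rightarrow> 'b::{real_normed_vector, heine_borel} set"
    and S2 :: "'b \<Rightarrow> 'c::real_normed_vector set"
  assumes closed: "closed (gph S1)" "closed (gph S2)"
    and t: "\<And>k. t k > 0" "t \<longlonglongrightarrow> 0"
    and lim: "u \<longlonglongrightarrow> u0" "w \<longlonglongrightarrow> w0"
    and y: "\<And>k. y k \<in> Xi S1 S2 (x0 + t k *\<^sub>R u k, z0 + t k *\<^sub>R w k)"
    and bound: "\<And>k. norm (y k - y0) \<le> t k * B"
  shows "y0 \<in> Xi S1 S2 (x0, z0)"
    and "w0 \<in> svm_comp (graph_deriv S2 y0 z0) (graph_deriv S1 x0 y0) u0"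
proof -
  have g: "(x0 + t k *\<^sub>R u k, y k) \<in> gph S1" "(y k, z0 + t k *\<^sub>R w k) \<in> gph S2" for k
    using y[of k] by (auto simp: mem_Xi_iff)
  have "(\<lambda>k. y k - y0) \<longlonglongrightarrow> 0"
    by (rule Lim_null_comparison[OF _ tendsto_mult_left_zero[OF t(2), of B]]) (simp add: bound)
  then have ylim: "y \<longlonglongrightarrow> y0"
    by (rule LIM_zero_cancel)
  have xlim: "(\<lambda>k. x0 + t k *\<^sub>R u k) \<longlonglongrightarrow> x0"
    using tendsto_add[OF tendsto_const[of x0] tendsto_scaleR[OF t(2) lim(1)]] by simp
  have zlim: "(\<lambda>k. z0 + t k *\<^sub>R w k) \<longlonglongrightarrow> z0"
    using tendsto_add[OF tendsto_const[of z0] tendsto_scaleR[OF t(2) lim(2)]] by simp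
  have "(x0, y0) \<in> gph S1"
    by (rule closed_sequentially[OF closed(1) _ tendsto_Pair[OF xlim ylim]]) (rule g)
  moreover have "(y0, z0) \<in> gph S2"
    by (rule closed_sequentially[OF closed(2) _ tendsto_Pair[OF ylim zlim]]) (rule g)
  ultimately show "y0 \<in> Xi S1 S2 (x0, z0)"
    by (simp add: mem_Xi_iff)

  define q where "q k = (y k - y0) /\<^sub>R t k" for k
  have "norm (q k) \<le> B" for k
    using bound[of k] t(1)[of k] by (simp add: q_def divide_simps mult.commute)
  then have "bounded (range q)"
    by (auto simp: bounded_iff)
  then obtain v r where r: "strict_mono r" and v: "(q \<circ> r) \<longlonglongrightarrow> v"
    using bounded_imp_convergent_subsequence by blast
  have tr: "(\<lambda>k. t (r k)) \<longlonglongrightarrow> 0" and ur: "(\<lambda>k. u (r k)) \<longlonglongrightarrow> u0" and wr: "(\<lambda>k. w (r k)) \<longlonglongrightarrow> w0"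
    using LIMSEQ_subseq_LIMSEQ[OF _ r] t(2) lim by (force simp: comp_def)+
  have qr: "(\<lambda>k. q (r k)) \<longlonglongrightarrow> v"
    using v by (simp add: comp_def)
  have tne: "t k \<noteq> 0" for k
    using t(1)[of k] by simp
  have "(u0, v) \<in> tangent_cone (gph S1) (x0, y0)"
  proof (rule tangent_coneI[OF t(1) tr])
    show "\<forall>\<^sub>F k in sequentially. (x0 + t (r k) *\<^sub>R u (r k), y (r k)) \<in> gph S1"
      using g by simp
    show "(\<lambda>k. ((x0 + t (r k) *\<^sub>R u (r k), y (r k)) - (x0, y0)) /\<^sub>R t (r k)) \<longlonglongrightarrow> (u0, v)"
      using tendsto_Pair[OF ur qr] by (simp add: q_def tne)
  qed
  moreover have "(v, w0) \<in> tangent_cone (gph S2) (y0, z0)"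
  proof (rule tangent_coneI[OF t(1) tr])
    show "\<forall>\<^sub>F k in sequentially. (y (r k), z0 + t (r k) *\<^sub>R w (r k)) \<in> gph S2"
      using g by simp
    show "(\<lambda>k. ((y (r k), z0 + t (r k) *\<^sub>R w (r k)) - (y0, z0)) /\<^sub>R t (r k)) \<longlonglongrightarrow> (v, w0)"
      using tendsto_Pair[OF qr wr] by (simp add: q_def tne)
  qed
  ultimately show "w0 \<in> svm_comp (graph_deriv S2 y0 z0) (graph_deriv S1 x0 y0) u0"
    by (auto simp: svm_comp_def graph_deriv_def)
qed

text \<open>The sequences that witness tangency of \<open>(u, w)\<close> are discarded: they only certify that the
  normalised direction is tangent, and calmness then provides better sequences for it.\<close>

lemma graph_deriv_comp_subset:
  fixes S1 :: "'a::real_normed_vector \<Rightarrow> 'b::{real_normed_vector, heine_borel} set"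
    and S2 :: "'b \<Rightarrow> 'c::real_normed_vector set"
  assumes closed: "closed (gph S1)" "closed (gph S2)"
    and mem: "(x0, z0) \<in> gph (svm_comp S2 S1)"
    and calm: "inner_calm_star_fuzzy (Xi S1 S2) (x0, z0) (svm_dom (Xi S1 S2))"
  shows "graph_deriv (svm_comp S2 S1) x0 z0 u \<subseteq>
    (\<Union>y \<in> Xi S1 S2 (x0, z0). svm_comp (graph_deriv S2 y z0) (graph_deriv S1 x0 y) u)"
proof
  fix w assume "w \<in> graph_deriv (svm_comp S2 S1) x0 z0 u"
  then have tan: "(u, w) \<in> tangent_cone (svm_dom (Xi S1 S2)) (x0, z0)"
    by (simp add: graph_deriv_def svm_dom_Xi)
  show "w \<in> (\<Union>y \<in> Xi S1 S2 (x0, z0). svm_comp (graph_deriv S2 y z0) (graph_deriv S1 x0 y) u)"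
  proof (cases "(u, w) = 0")
    case True
    obtain y where y: "y \<in> Xi S1 S2 (x0, z0)"
      using mem unfolding svm_dom_Xi[symmetric] svm_dom_def by blast
    then have "0 \<in> graph_deriv S1 x0 y 0" "0 \<in> graph_deriv S2 y z0 0"
      using zero_in_tangent_cone[of "(x0, y)" "gph S1"] zero_in_tangent_cone[of "(y, z0)" "gph S2"]
      by (simp_all add: mem_Xi_iff graph_deriv_def zero_prod_def)
    with y True show ?thesis
      by (auto simp: svm_comp_def zero_prod_def)
  next
    case False
    define c where "c = norm (u, w)"
    have c: "c > 0"
      using False by (simp add: c_def)
    define u' w' where "u' = u /\<^sub>R c" and "w' = w /\<^sub>R c"
    have "(u', w') = (1 / c) *\<^sub>R (u, w)"
      by (simp add: u'_def w'_def divide_inverse)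
    then have "norm (u', w') = 1" "(u', w') \<in> tangent_cone (svm_dom (Xi S1 S2)) (x0, z0)"
      using tangent_cone_scaleR[OF tan, of "1 / c"] c
      by (simp_all add: c_def del: scaleR_Pair)
    then obtain \<kappa> p t d y y0 where \<kappa>: "\<kappa> > 0"
      and t: "\<And>k::nat. t k > 0" "t \<longlonglongrightarrow> 0"
      and d: "d \<longlonglongrightarrow> (u', w')" and p: "\<And>k. p k = (x0, z0) + t k *\<^sub>R d k"
      and y: "\<And>k. y k \<in> Xi S1 S2 (p k)"
      and est: "\<And>k. norm (y k - y0) \<le> \<kappa> * norm (p k - (x0, z0))"
      using calm unfolding inner_calm_star_fuzzy_def by blast
    obtain D where D: "\<And>k. norm (d k) \<le> D"
      using convergent_imp_Bseq[of d] d by (auto simp: convergent_def Bseq_def)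
    have bound: "norm (y k - y0) \<le> t k * (\<kappa> * D)" for k
    proof -
      have "norm (y k - y0) \<le> \<kappa> * (t k * norm (d k))"
        using est[of k] t(1)[of k] by (simp add: p)
      also have "\<dots> \<le> \<kappa> * (t k * D)"
        using D[of k] t(1)[of k] \<kappa> by (simp add: mult_left_mono)
      finally show ?thesis
        by (simp add: ac_simps)
    qed
    have mem': "y k \<in> Xi S1 S2 (x0 + t k *\<^sub>R fst (d k), z0 + t k *\<^sub>R snd (d k))" for k
      using y[of k] by (cases "d k") (simp add: p)
    have lim: "(\<lambda>k. fst (d k)) \<longlonglongrightarrow> u'" "(\<lambda>k. snd (d k)) \<longlonglongrightarrow> w'"
      using tendsto_fst[OF d] tendsto_snd[OF d] by simp_all
    note * = intermediate_direction[OF closed t lim mem' bound]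
    have "c *\<^sub>R u' = u" "c *\<^sub>R w' = w"
      using c by (simp_all add: u'_def w'_def)
    then have "w \<in> svm_comp (graph_deriv S2 y0 z0) (graph_deriv S1 x0 y0) u"
      using svm_comp_graph_deriv_scaleR[OF *(2) c] by simp
    with *(1) show ?thesis
      by blast
  qed
qed

section \<open>The lower estimate\<close>

lemma zero_in_F_map_iff:
  "((0, 0), (0, 0)) \<in> F_map S1 S2 (x, z, y) \<longleftrightarrow> y \<in> Xi S1 S2 (x, z)"
  by (force simp: F_map_def mem_Xi_iff zero_prod_def image_iff)

text \<open>If the two middle points \<open>y\<close> and \<open>y'\<close> do not match, \<open>F\<close> at \<open>(x, z, y)\<close> still has the element
  \<open>((0, 0), (y' - y, 0))\<close>, so the mismatch bounds its residual.\<close>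

lemma F_map_residual:
  assumes "(x, y) \<in> gph S1" "(y', z) \<in> gph S2"
  shows "F_map S1 S2 (x, z, y) \<noteq> {}"
    and "infdist ((0, 0), (0, 0)) (F_map S1 S2 (x, z, y)) \<le> norm (y' - y)"
proof -
  have *: "((0, 0), (y' - y, 0)) \<in> F_map S1 S2 (x, z, y)"
    using assms
    by (auto simp: F_map_def zero_prod_def image_iff intro!: bexI[of _ "(x, y)"] bexI[of _ "(y', z)"])
  then show "F_map S1 S2 (x, z, y) \<noteq> {}"
    by blast
  show "infdist ((0, 0), (0, 0)) (F_map S1 S2 (x, z, y)) \<le> norm (y' - y)"
    using infdist_le[OF *, of "((0, 0), (0, 0))"]
    by (simp add: dist_Pair_Pair)
qed

text \<open>The infimum in the distance to the solution set need not be attained, so the correction is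
  taken up to an arbitrary slack \<open>\<epsilon>\<close>.\<close>

lemma subregular_correction:
  assumes "metrically_subregular (F_map S1 S2) (x0, z0, y0) ((0, 0), (0, 0))"
  obtains \<kappa> U where "\<kappa> > 0" "open U" "(x0, z0, y0) \<in> U"
    and "\<And>x y y' z \<epsilon>. (x, z, y) \<in> U \<Longrightarrow> (x, y) \<in> gph S1 \<Longrightarrow> (y', z) \<in> gph S2 \<Longrightarrow> \<epsilon> > 0 \<Longrightarrow>
      \<exists>q \<in> gph (svm_comp S2 S1). dist (x, z) q \<le> \<kappa> * norm (y' - y) + \<epsilon>"
proof -
  let ?Z = "svm_inv (F_map S1 S2) ((0, 0), (0, 0))"
  obtain \<kappa> U where \<kappa>: "\<kappa> > 0" and U: "open U" "(x0, z0, y0) \<in> U"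
    and est: "\<And>x. x \<in> U \<Longrightarrow> F_map S1 S2 x \<noteq> {} \<Longrightarrow>
      infdist x ?Z \<le> \<kappa> * infdist ((0, 0), (0, 0)) (F_map S1 S2 x)"
    and ne: "(x0, z0, y0) \<in> ?Z"
    using assms unfolding metrically_subregular_def by (auto simp: gph_def svm_inv_def)
  have "\<exists>q \<in> gph (svm_comp S2 S1). dist (x, z) q \<le> \<kappa> * norm (y' - y) + \<epsilon>"
    if "(x, z, y) \<in> U" "(x, y) \<in> gph S1" "(y', z) \<in> gph S2" "\<epsilon> > 0" for x y y' z \<epsilon>
  proof -
    have "infdist (x, z, y) ?Z \<le> \<kappa> * infdist ((0, 0), (0, 0)) (F_map S1 S2 (x, z, y))"
      by (rule est[OF that(1) F_map_residual(1)[OF that(2,3)]])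
    also have "\<dots> \<le> \<kappa> * norm (y' - y)"
      using F_map_residual(2)[OF that(2,3)] \<kappa> by (intro mult_left_mono) auto
    finally have "infdist (x, z, y) ?Z < \<kappa> * norm (y' - y) + \<epsilon>"
      using that(4) by simp
    then have "(INF a\<in>?Z. dist (x, z, y) a) < \<kappa> * norm (y' - y) + \<epsilon>"
      using ne by (auto simp: infdist_def split: if_splits)
    then obtain a where a: "a \<in> ?Z" "dist (x, z, y) a < \<kappa> * norm (y' - y) + \<epsilon>"
      using ne by (subst (asm) cINF_less_iff) (auto intro: bdd_belowI2[where m = 0])
    obtain x1 z1 y1 where a_eq: "a = (x1, z1, y1)"
      by (cases a)
    have "y1 \<in> Xi S1 S2 (x1, z1)"
      using a(1) by (simp add: a_eq svm_inv_def zero_in_F_map_iff)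
    then have "(x1, z1) \<in> gph (svm_comp S2 S1)"
      unfolding svm_dom_Xi[symmetric] svm_dom_def by blast
    moreover have "dist (x, z) (x1, z1) \<le> dist (x, z, y) a"
      by (simp add: a_eq dist_Pair_Pair)
    ultimately show ?thesis
      using a(2) by (intro bexI[of _ "(x1, z1)"]) auto
  qed
  with \<kappa> U show thesis
    by (rule that)
qed

text \<open>Tangency to the product of the graphs makes both graphs use the same step lengths, so the
  two middle points differ by \<open>t k *\<^sub>R (b' k - b k)\<close> with \<open>b' k - b k \<longlonglongrightarrow> 0\<close>. The corrected points
  therefore have the same limiting difference quotient as the uncorrected ones.\<close>

lemma comp_subset_graph_deriv:
  fixes S1 :: "'a::real_normed_vector \<Rightarrow> 'b::real_normed_vector set"
    and S2 :: "'b \<Rightarrow> 'c::real_normed_vector set"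
  assumes sub: "metrically_subregular (F_map S1 S2) (x0, z0, y0) ((0, 0), (0, 0))"
    and tan: "((u, v), (v, w)) \<in> tangent_cone (gph S1 \<times> gph S2) ((x0, y0), (y0, z0))"
  shows "w \<in> graph_deriv (svm_comp S2 S1) x0 z0 u"
proof -
  obtain \<kappa> U where \<kappa>: "\<kappa> > 0" and U: "open U" "(x0, z0, y0) \<in> U"
    and corr: "\<And>x y y' z \<epsilon>. (x, z, y) \<in> U \<Longrightarrow> (x, y) \<in> gph S1 \<Longrightarrow> (y', z) \<in> gph S2 \<Longrightarrow> \<epsilon> > 0 \<Longrightarrow>
      \<exists>q \<in> gph (svm_comp S2 S1). dist (x, z) q \<le> \<kappa> * norm (y' - y) + \<epsilon>"
    using sub by (rule subregular_correction) blast
  obtain t d where t: "\<And>k::nat. t k > 0" "t \<longlonglongrightarrow> 0" and d: "d \<longlonglongrightarrow> ((u, v), (v, w))"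
    and mem: "\<And>k. ((x0, y0), (y0, z0)) + t k *\<^sub>R d k \<in> gph S1 \<times> gph S2"
    using tan unfolding tangent_cone_def by blast
  define a b b' e where "a k = fst (fst (d k))" and "b k = snd (fst (d k))"
    and "b' k = fst (snd (d k))" and "e k = snd (snd (d k))" for k
  have lim: "a \<longlonglongrightarrow> u" "b \<longlonglongrightarrow> v" "b' \<longlonglongrightarrow> v" "e \<longlonglongrightarrow> w"
    using tendsto_fst[OF tendsto_fst[OF d]] tendsto_snd[OF tendsto_fst[OF d]]
      tendsto_fst[OF tendsto_snd[OF d]] tendsto_snd[OF tendsto_snd[OF d]]
    by (simp_all add: a_def[abs_def] b_def[abs_def] b'_def[abs_def] e_def[abs_def])
  have g1: "(x0 + t k *\<^sub>R a k, y0 + t k *\<^sub>R b k) \<in> gph S1"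
    and g2: "(y0 + t k *\<^sub>R b' k, z0 + t k *\<^sub>R e k) \<in> gph S2" for k
    using mem[of k] by (cases "d k"; auto simp: a_def b_def b'_def e_def plus_prod_def)+
  define P where "P k = (x0 + t k *\<^sub>R a k, z0 + t k *\<^sub>R e k)" for k
  \<comment> \<open>The slack \<open>t k * t k\<close> is of smaller order than the step length.\<close>
  define c where "c k = \<kappa> * norm (b' k - b k) + t k" for k
  have "(\<lambda>k. (x0 + t k *\<^sub>R a k, z0 + t k *\<^sub>R e k, y0 + t k *\<^sub>R b k))
      \<longlonglongrightarrow> (x0 + 0 *\<^sub>R u, z0 + 0 *\<^sub>R w, y0 + 0 *\<^sub>R v)"
    by (intro tendsto_intros t lim)
  then have ev: "\<forall>\<^sub>F k in sequentially. (x0 + t k *\<^sub>R a k, z0 + t k *\<^sub>R e k, y0 + t k *\<^sub>R b k) \<in> U"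
    using U by (auto dest: topological_tendstoD)
  have corr': "\<exists>q \<in> gph (svm_comp S2 S1). dist (P k) q \<le> t k * c k"
    if "(x0 + t k *\<^sub>R a k, z0 + t k *\<^sub>R e k, y0 + t k *\<^sub>R b k) \<in> U" for k
  proof -
    have "(y0 + t k *\<^sub>R b' k) - (y0 + t k *\<^sub>R b k) = t k *\<^sub>R (b' k - b k)"
      by (simp add: algebra_simps)
    then have "norm ((y0 + t k *\<^sub>R b' k) - (y0 + t k *\<^sub>R b k)) = t k * norm (b' k - b k)"
      using t(1)[of k] by simp
    then have "\<kappa> * norm ((y0 + t k *\<^sub>R b' k) - (y0 + t k *\<^sub>R b k)) + t k * t k = t k * c k"
      by (simp only: c_def) (simp add: algebra_simps)
    then show ?thesis
      using corr[OF that g1 g2, of "t k * t k"] t(1)[of k] by (simp add: P_def)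
  qed
  \<comment> \<open>Outside \<open>U\<close> no corrected point is available, and \<open>P k\<close> itself serves as a placeholder.\<close>
  have "\<exists>q. dist (P k) q \<le> t k * c k \<and>
      ((x0 + t k *\<^sub>R a k, z0 + t k *\<^sub>R e k, y0 + t k *\<^sub>R b k) \<in> U \<longrightarrow> q \<in> gph (svm_comp S2 S1))" for k
  proof (cases "(x0 + t k *\<^sub>R a k, z0 + t k *\<^sub>R e k, y0 + t k *\<^sub>R b k) \<in> U")
    case True
    then show ?thesis
      using corr' by blast
  next
    case False
    have "0 \<le> t k * c k"
      using t(1)[of k] \<kappa> by (simp add: c_def)
    with False show ?thesis
      by (intro exI[of _ "P k"]) simp
  qed
  then obtain q where q: "\<And>k. dist (P k) (q k) \<le> t k * c k"
    and qU: "\<And>k. (x0 + t k *\<^sub>R a k, z0 + t k *\<^sub>R e k, y0 + t k *\<^sub>R b k) \<in> U \<Longrightarrow>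
      q k \<in> gph (svm_comp S2 S1)"
    by metis
  have qmem: "\<forall>\<^sub>F k in sequentially. q k \<in> gph (svm_comp S2 S1)"
    using ev by (rule eventually_mono) (rule qU)
  have "c \<longlonglongrightarrow> \<kappa> * norm (v - v) + 0"
    unfolding c_def by (intro tendsto_intros t lim)
  then have c: "c \<longlonglongrightarrow> 0"
    by simp
  have "norm ((q k - P k) /\<^sub>R t k) \<le> c k" for k
  proof -
    have "norm (q k - P k) / t k \<le> c k"
      using q[of k] t(1)[of k]
      by (simp only: dist_norm norm_minus_commute[of "P k"] pos_divide_le_eq mult.commute[of "c k"])
    moreover have "norm ((q k - P k) /\<^sub>R t k) = norm (q k - P k) / t k"
      using t(1)[of k] by (simp add: divide_inverse_commute)
    ultimately show ?thesis
      by (simp only:)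
  qed
  then have "(\<lambda>k. (q k - P k) /\<^sub>R t k) \<longlonglongrightarrow> 0"
    by (intro Lim_null_comparison[OF _ c] always_eventually allI)
  then have "(\<lambda>k. (a k, e k) + (q k - P k) /\<^sub>R t k) \<longlonglongrightarrow> (u, w) + 0"
    by (intro tendsto_add tendsto_Pair lim)
  moreover have "(a k, e k) + (q k - P k) /\<^sub>R t k = (q k - (x0, z0)) /\<^sub>R t k" for k
  proof -
    have "P k = (x0, z0) + t k *\<^sub>R (a k, e k)"
      by (simp add: P_def)
    moreover have "(t k *\<^sub>R (a k, e k)) /\<^sub>R t k = (a k, e k)"
      using t(1)[of k] by simp
    ultimately show ?thesis
      by (simp only: scaleR_diff_right scaleR_add_right) simp
  qed
  ultimately have "(\<lambda>k. (q k - (x0, z0)) /\<^sub>R t k) \<longlonglongrightarrow> (u, w)"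
    by simp
  then show ?thesis
    unfolding graph_deriv_def using tangent_coneI[OF t qmem] by simp
qed

section \<open>The chain rule\<close>

theorem theorem4p5:
  fixes S1 :: "real ^ 'n \<Rightarrow> (real ^ 'm) set"
    and S2 :: "real ^ 'm \<Rightarrow> (real ^ 's) set"
    and S :: "real ^ 'n \<Rightarrow> (real ^ 's) set"
    and xb :: "real ^ 'n" and zb :: "real ^ 's"
  assumes "closed (gph S1)"
    and "closed (gph S2)"
    and "S = svm_comp S2 S1"
    and "(xb, zb) \<in> gph S"
    and "inner_semicompact (Xi S1 S2) (xb, zb) (svm_dom (Xi S1 S2))"
  shows "(inner_calm_star_fuzzy (Xi S1 S2) (xb, zb) (svm_dom (Xi S1 S2)) \<longrightarrow>
            (\<forall>u. graph_deriv S xb zb u \<subseteq>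
               (\<Union>yb \<in> Xi S1 S2 (xb, zb).
                  svm_comp (graph_deriv S2 yb zb) (graph_deriv S1 xb yb) u)))
       \<and> (\<forall>yb \<in> Xi S1 S2 (xb, zb).
            metrically_subregular (F_map S1 S2) (xb, zb, yb) ((0, 0), (0, 0)) \<and>
            (\<forall>(u :: real ^ 'n) (v :: real ^ 'm) (w :: real ^ 's).
               ((u, v), (v, w)) \<in> tangent_cone (gph S1 \<times> gph S2) ((xb, yb), (yb, zb)) \<longleftrightarrow>
               (u, v) \<in> tangent_cone (gph S1) (xb, yb) \<and>
               (v, w) \<in> tangent_cone (gph S2) (yb, zb)) \<longrightarrow>
            (\<forall>u. svm_comp (graph_deriv S2 yb zb) (graph_deriv S1 xb yb) u \<subseteq>
               graph_deriv S xb zb u))"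
proof (intro conjI impI allI ballI)
  fix u
  assume "inner_calm_star_fuzzy (Xi S1 S2) (xb, zb) (svm_dom (Xi S1 S2))"
  then show "graph_deriv S xb zb u \<subseteq>
      (\<Union>yb \<in> Xi S1 S2 (xb, zb). svm_comp (graph_deriv S2 yb zb) (graph_deriv S1 xb yb) u)"
    using graph_deriv_comp_subset[OF assms(1,2)] assms(3,4) by blast
next
  fix yb u
  assume hyp: "metrically_subregular (F_map S1 S2) (xb, zb, yb) ((0, 0), (0, 0)) \<and>
    (\<forall>u v w. ((u, v), (v, w)) \<in> tangent_cone (gph S1 \<times> gph S2) ((xb, yb), (yb, zb)) \<longleftrightarrow>
      (u, v) \<in> tangent_cone (gph S1) (xb, yb) \<and> (v, w) \<in> tangent_cone (gph S2) (yb, zb))"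
  show "svm_comp (graph_deriv S2 yb zb) (graph_deriv S1 xb yb) u \<subseteq> graph_deriv S xb zb u"
  proof
    fix w
    assume "w \<in> svm_comp (graph_deriv S2 yb zb) (graph_deriv S1 xb yb) u"
    then obtain v where "(u, v) \<in> tangent_cone (gph S1) (xb, yb)"
      and "(v, w) \<in> tangent_cone (gph S2) (yb, zb)"
      by (auto simp: svm_comp_def graph_deriv_def)
    with hyp have "((u, v), (v, w)) \<in> tangent_cone (gph S1 \<times> gph S2) ((xb, yb), (yb, zb))"
      by blast
    with hyp show "w \<in> graph_deriv S xb zb u"
      unfolding assms(3) by (blast intro: comp_subset_graph_deriv)
  qed
qed

end
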